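(* Let $f,g\colon K\to L$ be simplicial maps between simplicial complexes. Then: (i) If $f\sim g$ (same contiguity class), then $f\simeq g$ ($P$-homotopic). (ii) If $K$ is finite and $f\simeq g$, then $f\sim g$. In particular, if $K$ is finite, then $f$ and $g$ are in the same contiguity class if and only if they are $P$-homotopic.
   Context: Simplicial complexes are abstract simplicial complexes, not necessarily finite; simplicial maps are maps of vertex sets sending simplices to simplices. Simplicial maps $\varphi,\psi\colon K\to L$ are contiguous if $\varphi(\sigma)\cup\psi(\sigma)$ is a simplex of $L$ for every simplex $\sigma$ of $K$; they are in the same contiguity class, $\varphi\sim\psi$, if they are joined by a finite sequence of simplicial maps with consecutive ones contiguous. Let $Z$ be the one-dimensional simplicial complex with vertex set $\mathbb Z$ and edges $\{i,i+1\}$. A Moore path in $L$ is a simplicial map $\gamma\colon Z\to L$ that is constant on all sufficiently small integers (with value the initial vertex $\alpha(\gamma)$) and constant on all sufficiently large integers (with value the final vertex $\omega(\gamma)$). The Moore path complex $\mathrm{P}L$ has as vertices all Moore paths in $L$, and a finite set $\{\gamma_0,\dots,\gamma_p\}$ is a simplex iff $\{\gamma_0(i),\dots,\gamma_p(i),\gamma_0(i+1),\dots,\gamma_p(i+1)\}$ is a simplex of $L$ for every $i\in\mathbb Z$; $\alpha,\omega\colon \mathrm{P}L\to L$ are simplicial maps. Simplicial maps $f,g\colon K\to L$ are $P$-homotopic, $f\simeq g$, if there is a simplicial map $H\colon K\to \mathrm{P}L$ with $\alpha\circ H=f$ and $\omega\circ H=g$. *)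

theory Defs
  imports Main
begin

text \<open>
  An abstract simplicial complex is represented by its set of simplices, which are finite and
  nonempty; its vertex set is the union of the simplices. Not to be confused with the geometric
  \<open>simplicial_complex\<close> of HOL-Analysis.
\<close>

definition abstract_simplicial_complex :: "'a set set \<Rightarrow> bool" where
  "abstract_simplicial_complex K \<longleftrightarrow>
     (\<forall>\<sigma>\<in>K. finite \<sigma> \<and> \<sigma> \<noteq> {} \<and> (\<forall>\<tau>. \<tau> \<subseteq> \<sigma> \<and> \<tau> \<noteq> {} \<longrightarrow> \<tau> \<in> K))"

definition vertices :: "'a set set \<Rightarrow> 'a set" where
  "vertices K = \<Union>K"

text \<open>
  HOL functions are total, so a simplicial map is only meaningful on \<^term>\<open>vertices K\<close>; no
  notion below depends on its values elsewhere. (Two simplicial maps that agree on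
  \<^term>\<open>vertices K\<close> are contiguous, so also \<open>same_contiguity_class\<close> does not.)
\<close>

definition simplicial_map :: "'a set set \<Rightarrow> 'b set set \<Rightarrow> ('a \<Rightarrow> 'b) \<Rightarrow> bool" where
  "simplicial_map K L \<phi> \<longleftrightarrow> (\<forall>\<sigma>\<in>K. \<phi> ` \<sigma> \<in> L)"

definition contiguous :: "'a set set \<Rightarrow> 'b set set \<Rightarrow> ('a \<Rightarrow> 'b) \<Rightarrow> ('a \<Rightarrow> 'b) \<Rightarrow> bool" where
  "contiguous K L \<phi> \<psi> \<longleftrightarrow> (\<forall>\<sigma>\<in>K. \<phi> ` \<sigma> \<union> \<psi> ` \<sigma> \<in> L)"

definition same_contiguity_class ::
    "'a set set \<Rightarrow> 'b set set \<Rightarrow> ('a \<Rightarrow> 'b) \<Rightarrow> ('a \<Rightarrow> 'b) \<Rightarrow> bool" where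
  "same_contiguity_class K L \<phi> \<psi> \<longleftrightarrow>
     (\<exists>(n::nat) h. h 0 = \<phi> \<and> h n = \<psi> \<and>
        (\<forall>i\<le>n. simplicial_map K L (h i)) \<and>
        (\<forall>i<n. contiguous K L (h i) (h (Suc i))))"

definition int_line :: "int set set" where
  "int_line = range (\<lambda>i. {i}) \<union> range (\<lambda>i. {i, i + 1})"

definition moore_paths :: "'b set set \<Rightarrow> (int \<Rightarrow> 'b) set" where
  "moore_paths L = {\<gamma>. simplicial_map int_line L \<gamma> \<and>
     (\<exists>v m. \<forall>i\<le>m. \<gamma> i = v) \<and> (\<exists>v m. \<forall>i\<ge>m. \<gamma> i = v)}"

definition initial_vertex :: "(int \<Rightarrow> 'b) \<Rightarrow> 'b" where
  "initial_vertex \<gamma> = (THE v. \<exists>m. \<forall>i\<le>m. \<gamma> i = v)"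

definition final_vertex :: "(int \<Rightarrow> 'b) \<Rightarrow> 'b" where
  "final_vertex \<gamma> = (THE v. \<exists>m. \<forall>i\<ge>m. \<gamma> i = v)"

definition moore_path_complex :: "'b set set \<Rightarrow> (int \<Rightarrow> 'b) set set" where
  "moore_path_complex L = {\<Gamma>. finite \<Gamma> \<and> \<Gamma> \<noteq> {} \<and> \<Gamma> \<subseteq> moore_paths L \<and>
     (\<forall>i. (\<Union>\<gamma>\<in>\<Gamma>. {\<gamma> i, \<gamma> (i + 1)}) \<in> L)}"

definition P_homotopic :: "'a set set \<Rightarrow> 'b set set \<Rightarrow> ('a \<Rightarrow> 'b) \<Rightarrow> ('a \<Rightarrow> 'b) \<Rightarrow> bool" where
  "P_homotopic K L f g \<longleftrightarrow>
     (\<exists>H. simplicial_map K (moore_path_complex L) H \<and>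
        (\<forall>v\<in>vertices K. initial_vertex (H v) = f v \<and> final_vertex (H v) = g v))"

lemma abstract_simplicial_complex_face:
  assumes "abstract_simplicial_complex K" "\<sigma> \<in> K" "\<tau> \<subseteq> \<sigma>" "\<tau> \<noteq> {}"
  shows "\<tau> \<in> K"
proof -
  have "\<forall>\<tau>. \<tau> \<subseteq> \<sigma> \<and> \<tau> \<noteq> {} \<longrightarrow> \<tau> \<in> K"
    using bspec[OF assms(1)[unfolded abstract_simplicial_complex_def] assms(2)] by (elim conjE)
  from mp[OF spec[OF this] conjI[OF assms(3,4)]] show ?thesis .
qed

lemma abstract_simplicial_complex_int_line: "abstract_simplicial_complex int_line"
  unfolding abstract_simplicial_complex_def
proof (intro ballI conjI allI impI)
  fix \<sigma> \<tau> assume \<sigma>: "\<sigma> \<in> int_line" and \<tau>: "\<tau> \<subseteq> \<sigma> \<and> \<tau> \<noteq> {}"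
  from \<sigma> obtain i where "\<sigma> = {i} \<or> \<sigma> = {i, i + 1}"
    unfolding int_line_def by blast
  then have "\<tau> = {i} \<or> \<tau> = {i + 1} \<or> \<tau> = {i, i + 1}" using \<tau> by blast
  then show "\<tau> \<in> int_line" unfolding int_line_def by blast
qed (auto simp: int_line_def)

lemma initial_vertex_eq:
  assumes "\<forall>i\<le>m. \<gamma> i = v"
  shows "initial_vertex \<gamma> = v"
  unfolding initial_vertex_def
proof (rule the_equality)
  fix w assume "\<exists>n. \<forall>i\<le>n. \<gamma> i = w"
  then obtain n where "\<forall>i\<le>n. \<gamma> i = w" ..
  then have "\<gamma> (min m n) = w" by simp
  moreover have "\<gamma> (min m n) = v" using assms by simp
  ultimately show "w = v" by simp
qed (use assms in blast)

lemma final_vertex_eq: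
  assumes "\<forall>i\<ge>m. \<gamma> i = v"
  shows "final_vertex \<gamma> = v"
  unfolding final_vertex_def
proof (rule the_equality)
  fix w assume "\<exists>n. \<forall>i\<ge>n. \<gamma> i = w"
  then obtain n where "\<forall>i\<ge>n. \<gamma> i = w" ..
  then have "\<gamma> (max m n) = w" by simp
  moreover have "\<gamma> (max m n) = v" using assms by simp
  ultimately show "w = v" by simp
qed (use assms in blast)

lemma abstract_simplicial_complex_moore_path_complex:
  assumes L: "abstract_simplicial_complex L"
  shows "abstract_simplicial_complex (moore_path_complex L)"
  unfolding abstract_simplicial_complex_def
proof (intro ballI conjI allI impI)
  fix \<Gamma> \<Delta> assume \<Gamma>: "\<Gamma> \<in> moore_path_complex L" and \<Delta>: "\<Delta> \<subseteq> \<Gamma> \<and> \<Delta> \<noteq> {}"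
  have "(\<Union>\<gamma>\<in>\<Delta>. {\<gamma> i, \<gamma> (i + 1)}) \<in> L" for i
  proof -
    have "(\<Union>\<gamma>\<in>\<Gamma>. {\<gamma> i, \<gamma> (i + 1)}) \<in> L"
      using \<Gamma> by (simp add: moore_path_complex_def)
    moreover have "(\<Union>\<gamma>\<in>\<Delta>. {\<gamma> i, \<gamma> (i + 1)}) \<subseteq> (\<Union>\<gamma>\<in>\<Gamma>. {\<gamma> i, \<gamma> (i + 1)})"
      using \<Delta> by blast
    moreover have "(\<Union>\<gamma>\<in>\<Delta>. {\<gamma> i, \<gamma> (i + 1)}) \<noteq> {}"
      using \<Delta> by blast
    ultimately show ?thesis
      using abstract_simplicial_complex_face[OF L] by simp
  qed
  then show "\<Delta> \<in> moore_path_complex L"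
    using \<Gamma> \<Delta> by (auto simp: moore_path_complex_def intro: finite_subset)
qed (auto simp: moore_path_complex_def)

lemma vertices_moore_path_complex: "vertices (moore_path_complex L) = moore_paths L"
proof
  show "vertices (moore_path_complex L) \<subseteq> moore_paths L"
    by (auto simp: vertices_def moore_path_complex_def)
next
  show "moore_paths L \<subseteq> vertices (moore_path_complex L)"
  proof
    fix \<gamma> assume \<gamma>: "\<gamma> \<in> moore_paths L"
    have "{\<gamma> i, \<gamma> (i + 1)} \<in> L" for i
    proof -
      have "\<gamma> ` {i, i + 1} \<in> L"
        using \<gamma> unfolding moore_paths_def simplicial_map_def int_line_def by blast
      then show ?thesis by simp
    qed
    then have "{\<gamma>} \<in> moore_path_complex L"
      using \<gamma> by (simp add: moore_path_complex_def)
    then show "\<gamma> \<in> vertices (moore_path_complex L)"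
      by (auto simp: vertices_def)
  qed
qed

lemma simplicial_map_initial_vertex:
  assumes L: "abstract_simplicial_complex L"
  shows "simplicial_map (moore_path_complex L) L initial_vertex"
  unfolding simplicial_map_def
proof
  fix \<Gamma> assume \<Gamma>: "\<Gamma> \<in> moore_path_complex L"
  have "\<forall>\<gamma>\<in>\<Gamma>. \<exists>m. \<forall>i\<le>m. \<gamma> i = initial_vertex \<gamma>"
  proof
    fix \<gamma> assume "\<gamma> \<in> \<Gamma>"
    then have "\<gamma> \<in> moore_paths L" using \<Gamma> by (auto simp: moore_path_complex_def)
    then obtain v m where "\<forall>i\<le>m. \<gamma> i = v" unfolding moore_paths_def by blast
    then show "\<exists>m. \<forall>i\<le>m. \<gamma> i = initial_vertex \<gamma>" using initial_vertex_eq by metis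
  qed
  then obtain m where m: "\<forall>\<gamma>\<in>\<Gamma>. \<forall>i\<le>m \<gamma>. \<gamma> i = initial_vertex \<gamma>"
    by metis
  define k where "k = Min (m ` \<Gamma>)"
  have fin: "finite \<Gamma>" and ne: "\<Gamma> \<noteq> {}"
    and S: "(\<Union>\<gamma>\<in>\<Gamma>. {\<gamma> k, \<gamma> (k + 1)}) \<in> L"
    using \<Gamma> by (auto simp: moore_path_complex_def)
  have "\<forall>\<gamma>\<in>\<Gamma>. \<gamma> k = initial_vertex \<gamma>"
    using m fin by (simp add: k_def)
  then have "initial_vertex ` \<Gamma> \<subseteq> (\<Union>\<gamma>\<in>\<Gamma>. {\<gamma> k, \<gamma> (k + 1)})" by auto
  moreover have "initial_vertex ` \<Gamma> \<noteq> {}" using ne by simp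
  ultimately show "initial_vertex ` \<Gamma> \<in> L"
    using abstract_simplicial_complex_face[OF L S] by simp
qed

lemma simplicial_map_final_vertex:
  assumes L: "abstract_simplicial_complex L"
  shows "simplicial_map (moore_path_complex L) L final_vertex"
  unfolding simplicial_map_def
proof
  fix \<Gamma> assume \<Gamma>: "\<Gamma> \<in> moore_path_complex L"
  have "\<forall>\<gamma>\<in>\<Gamma>. \<exists>m. \<forall>i\<ge>m. \<gamma> i = final_vertex \<gamma>"
  proof
    fix \<gamma> assume "\<gamma> \<in> \<Gamma>"
    then have "\<gamma> \<in> moore_paths L" using \<Gamma> by (auto simp: moore_path_complex_def)
    then obtain v m where "\<forall>i\<ge>m. \<gamma> i = v" unfolding moore_paths_def by blast
    then show "\<exists>m. \<forall>i\<ge>m. \<gamma> i = final_vertex \<gamma>" using final_vertex_eq by metis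
  qed
  then obtain m where m: "\<forall>\<gamma>\<in>\<Gamma>. \<forall>i\<ge>m \<gamma>. \<gamma> i = final_vertex \<gamma>"
    by metis
  define k where "k = Max (m ` \<Gamma>)"
  have fin: "finite \<Gamma>" and ne: "\<Gamma> \<noteq> {}"
    and S: "(\<Union>\<gamma>\<in>\<Gamma>. {\<gamma> k, \<gamma> (k + 1)}) \<in> L"
    using \<Gamma> by (auto simp: moore_path_complex_def)
  have "\<forall>\<gamma>\<in>\<Gamma>. \<gamma> k = final_vertex \<gamma>"
    using m fin by (simp add: k_def)
  then have "final_vertex ` \<Gamma> \<subseteq> (\<Union>\<gamma>\<in>\<Gamma>. {\<gamma> k, \<gamma> (k + 1)})" by auto
  moreover have "final_vertex ` \<Gamma> \<noteq> {}" using ne by simp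
  ultimately show "final_vertex ` \<Gamma> \<in> L"
    using abstract_simplicial_complex_face[OF L S] by simp
qed

end

theory Submission
  imports Defs
begin

text \<open>
  Currying identifies a map \<open>H\<close> from \<open>K\<close> to the Moore path complex with the \<open>\<int>\<close>-indexed sequence
  of maps \<open>\<lambda>v. H v i\<close>, and \<open>H\<close> is simplicial exactly when consecutive members are contiguous and
  every \<open>H v\<close> stabilises on both sides. A finite sequence extended by constants stabilises;
  conversely, if \<open>K\<close> has finitely many vertices, all \<open>H v\<close> stabilise simultaneously, and finitely
  many members of the sequence suffice.
\<close>

text \<open>The filter form, here and at \<open>at_top\<close> below, lets
  \<open>eventually_ball_finite\<close> merge the separate bounds of finitely many paths into
  one.\<close>

lemma moore_path_eventually_initial:
  assumes "\<gamma> \<in> moore_paths L"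
  shows "\<forall>\<^sub>F i in at_bot. \<gamma> i = initial_vertex \<gamma>"
proof -
  obtain v m where "\<forall>i\<le>m. \<gamma> i = v"
    using assms unfolding moore_paths_def by blast
  with initial_vertex_eq[OF this] show ?thesis
    unfolding eventually_at_bot_linorder by blast
qed

lemma moore_path_eventually_final:
  assumes "\<gamma> \<in> moore_paths L"
  shows "\<forall>\<^sub>F i in at_top. \<gamma> i = final_vertex \<gamma>"
proof -
  obtain v m where "\<forall>i\<ge>m. \<gamma> i = v"
    using assms unfolding moore_paths_def by blast
  with final_vertex_eq[OF this] show ?thesis
    unfolding eventually_at_top_linorder by blast
qed

lemma finite_vertices:
  assumes "abstract_simplicial_complex K" "finite K"
  shows "finite (vertices K)"
  using assms by (auto simp: vertices_def abstract_simplicial_complex_def)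

lemma contiguous_refl:
  assumes "simplicial_map K L \<phi>"
  shows "contiguous K L \<phi> \<phi>"
  using assms by (simp add: contiguous_def simplicial_map_def)

lemma simplicial_map_cong:
  assumes "\<And>v. v \<in> vertices K \<Longrightarrow> \<phi> v = \<phi>' v"
  shows "simplicial_map K L \<phi> \<longleftrightarrow> simplicial_map K L \<phi>'"
proof -
  have "\<phi> ` \<sigma> = \<phi>' ` \<sigma>" if "\<sigma> \<in> K" for \<sigma>
    using assms that by (auto simp: vertices_def intro!: image_cong)
  then show ?thesis by (simp add: simplicial_map_def)
qed

lemma contiguous_cong:
  assumes "\<And>v. v \<in> vertices K \<Longrightarrow> \<phi> v = \<phi>' v" "\<And>v. v \<in> vertices K \<Longrightarrow> \<psi> v = \<psi>' v"
  shows "contiguous K L \<phi> \<psi> \<longleftrightarrow> contiguous K L \<phi>' \<psi>'"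
proof -
  have "\<phi> ` \<sigma> = \<phi>' ` \<sigma>" "\<psi> ` \<sigma> = \<psi>' ` \<sigma>" if "\<sigma> \<in> K" for \<sigma>
    using assms that by (auto simp: vertices_def intro!: image_cong)
  then show ?thesis by (simp add: contiguous_def)
qed

text \<open>Since \<sigma> is nonempty, its image is a nonempty face of the union required by
  contiguity.\<close>

lemma contiguous_imp_simplicial_map:
  assumes K: "abstract_simplicial_complex K" and L: "abstract_simplicial_complex L"
    and c: "contiguous K L \<phi> \<psi>"
  shows "simplicial_map K L \<phi>"
  unfolding simplicial_map_def
proof
  fix \<sigma> assume \<sigma>: "\<sigma> \<in> K"
  then have "\<phi> ` \<sigma> \<union> \<psi> ` \<sigma> \<in> L" using c by (simp add: contiguous_def)
  moreover have "\<sigma> \<noteq> {}" using K \<sigma> by (simp add: abstract_simplicial_complex_def)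
  ultimately show "\<phi> ` \<sigma> \<in> L"
    using abstract_simplicial_complex_face[OF L, of "\<phi> ` \<sigma> \<union> \<psi> ` \<sigma>" "\<phi> ` \<sigma>"] by simp
qed

lemma Union_steps_eq:
  "(\<Union>\<gamma>\<in>H ` \<sigma>. {\<gamma> i, \<gamma> (i + 1)}) = (\<lambda>v. H v i) ` \<sigma> \<union> (\<lambda>v. H v (i + 1)) ` \<sigma>"
  for H :: "'a \<Rightarrow> int \<Rightarrow> 'b"
  by auto

lemma contiguous_slices:
  assumes "simplicial_map K (moore_path_complex L) H"
  shows "contiguous K L (\<lambda>v. H v i) (\<lambda>v. H v (i + 1))"
  unfolding contiguous_def
proof
  fix \<sigma> assume "\<sigma> \<in> K"
  then have "H ` \<sigma> \<in> moore_path_complex L" using assms by (simp add: simplicial_map_def)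
  then have "(\<Union>\<gamma>\<in>H ` \<sigma>. {\<gamma> i, \<gamma> (i + 1)}) \<in> L"
    unfolding moore_path_complex_def by blast
  then show "(\<lambda>v. H v i) ` \<sigma> \<union> (\<lambda>v. H v (i + 1)) ` \<sigma> \<in> L"
    unfolding Union_steps_eq .
qed

lemma simplicial_map_of_contiguous_slices:
  assumes K: "abstract_simplicial_complex K" and L: "abstract_simplicial_complex L"
    and slices: "\<And>i. contiguous K L (\<lambda>v. H v i) (\<lambda>v. H v (i + 1))"
    and low: "\<And>v. v \<in> vertices K \<Longrightarrow> \<exists>w m. \<forall>i\<le>m. H v i = w"
    and high: "\<And>v. v \<in> vertices K \<Longrightarrow> \<exists>w m. \<forall>i\<ge>m. H v i = w"
  shows "simplicial_map K (moore_path_complex L) H"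
  unfolding simplicial_map_def
proof
  fix \<sigma> assume \<sigma>: "\<sigma> \<in> K"
  have step: "(\<lambda>v. H v i) ` \<sigma> \<union> (\<lambda>v. H v (i + 1)) ` \<sigma> \<in> L" for i
    using slices \<sigma> by (simp add: contiguous_def)
  have "H v \<in> moore_paths L" if v: "v \<in> \<sigma>" for v
  proof -
    \<comment> \<open>Both are nonempty faces of the simplex in \<open>step\<close>; they are the
      images under \<open>H v\<close> of the edges and the vertices of
      \<open>int_line\<close>.\<close>
    have pair: "{H v i, H v (i + 1)} \<in> L" and point: "{H v i} \<in> L" for i
      using v by (auto intro!: abstract_simplicial_complex_face[OF L step[of i]])
    have "v \<in> vertices K" using v \<sigma> by (auto simp: vertices_def)
    then show ?thesis
      using low high pair point
      by (auto simp: moore_paths_def simplicial_map_def int_line_def)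
  qed
  moreover have "finite \<sigma>" "\<sigma> \<noteq> {}"
    using K \<sigma> by (auto simp: abstract_simplicial_complex_def)
  ultimately show "H ` \<sigma> \<in> moore_path_complex L"
    using step unfolding moore_path_complex_def mem_Collect_eq Union_steps_eq by auto
qed

lemma same_contiguity_class_imp_P_homotopic:
  assumes K: "abstract_simplicial_complex K" and L: "abstract_simplicial_complex L"
    and "same_contiguity_class K L f g"
  shows "P_homotopic K L f g"
proof -
  obtain n h where h: "h 0 = f" "h n = g"
      "\<And>i. i \<le> n \<Longrightarrow> simplicial_map K L (h i)"
      "\<And>i. i < n \<Longrightarrow> contiguous K L (h i) (h (Suc i))"
    using assms(3) unfolding same_contiguity_class_def by blast
  \<comment> \<open>\<open>nat\<close> truncates negative integers to 0, so \<open>H v\<close> is constant on both ends.\<close>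
  define H where "H = (\<lambda>v i. h (nat (min i (int n))) v)"
  have low: "\<forall>i\<le>0. H v i = f v" and high: "\<forall>i\<ge>int n. H v i = g v" for v
    by (simp_all add: H_def h)
  have "contiguous K L (\<lambda>v. H v i) (\<lambda>v. H v (i + 1))" for i
  \<comment> \<open>Inside the range, adjacent slices are consecutive members of \<open>h\<close>;
    outside it the clamped index does not move, and a simplicial map is contiguous to
    itself.\<close>
  proof (cases "0 \<le> i \<and> i < int n")
    case True
    then have "nat (min (i + 1) (int n)) = Suc (nat (min i (int n)))" "nat (min i (int n)) < n"
      by auto
    then show ?thesis using h(4) by (simp add: H_def)
  next
    case False
    then have "nat (min (i + 1) (int n)) = nat (min i (int n))" "nat (min i (int n)) \<le> n"
      by auto
    then show ?thesis using h(3) by (simp add: H_def contiguous_refl)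
  qed
  then have "simplicial_map K (moore_path_complex L) H"
    using low high by (blast intro: simplicial_map_of_contiguous_slices[OF K L])
  then show ?thesis
    using initial_vertex_eq[OF low] final_vertex_eq[OF high] unfolding P_homotopic_def by blast
qed

lemma P_homotopic_imp_same_contiguity_class:
  assumes K: "abstract_simplicial_complex K" and L: "abstract_simplicial_complex L"
    and fin: "finite (vertices K)" and "P_homotopic K L f g"
  shows "same_contiguity_class K L f g"
proof -
  obtain H where H: "simplicial_map K (moore_path_complex L) H"
    and ends: "\<And>v. v \<in> vertices K \<Longrightarrow> initial_vertex (H v) = f v \<and> final_vertex (H v) = g v"
    using assms(4) unfolding P_homotopic_def by blast
  have path: "H v \<in> moore_paths L" if "v \<in> vertices K" for v
    using H that by (auto simp: vertices_def simplicial_map_def moore_path_complex_def)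
  have "\<forall>\<^sub>F i in at_bot. \<forall>v\<in>vertices K. H v i = f v"
    using moore_path_eventually_initial[OF path] ends by (intro eventually_ball_finite fin) auto
  then obtain m where m: "\<And>i v. i \<le> m \<Longrightarrow> v \<in> vertices K \<Longrightarrow> H v i = f v"
    unfolding eventually_at_bot_linorder by blast
  have "\<forall>\<^sub>F i in at_top. \<forall>v\<in>vertices K. H v i = g v"
    using moore_path_eventually_final[OF path] ends by (intro eventually_ball_finite fin) auto
  then obtain M where M: "\<And>i v. i \<ge> M \<Longrightarrow> v \<in> vertices K \<Longrightarrow> H v i = g v"
    unfolding eventually_at_top_linorder by blast
  \<comment> \<open>\<open>Suc\<close> keeps \<open>n\<close> positive even if
    \<open>M \<le> m\<close>, so that the values prescribed at 0 and \<open>n\<close> do not clash;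
    moreover \<open>m + int n \<ge> M\<close>.\<close>
  define n where "n = Suc (nat (M - m))"
  \<comment> \<open>The slices of \<open>H\<close> agree with \<open>f\<close> and \<open>g\<close> only on the vertices of \<open>K\<close>, while the ends of the
    sequence must equal \<open>f\<close> and \<open>g\<close> as total functions.\<close>
  define h where "h = (\<lambda>k. if k = 0 then f else if k = n then g else (\<lambda>v. H v (m + int k)))"
  \<comment> \<open>On the vertices, the replaced members at 0 and \<open>n\<close> are still the
    slices at \<open>m\<close> and \<open>m + int n\<close>, by the choice of \<open>m\<close> and
    \<open>M\<close>.\<close>
  have h_eq: "h k v = H v (m + int k)" if "v \<in> vertices K" for k v
    using that m[of m v] M[of "m + int n" v] by (auto simp: h_def n_def)
  have "simplicial_map K L (h k)" for k
    using contiguous_imp_simplicial_map[OF K L contiguous_slices[OF H]]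
    by (subst simplicial_map_cong[OF h_eq]) auto
  moreover have "contiguous K L (h k) (h (Suc k))" for k
    using contiguous_slices[OF H, of "m + int k"]
    by (subst contiguous_cong[OF h_eq h_eq]) (auto simp: algebra_simps)
  moreover have "h 0 = f" "h n = g" by (auto simp: h_def n_def)
  ultimately show ?thesis unfolding same_contiguity_class_def by blast
qed

theorem proposition5p10:
  fixes K :: "'a set set" and L :: "'b set set" and f g :: "'a \<Rightarrow> 'b"
  assumes "abstract_simplicial_complex K" and "abstract_simplicial_complex L"
    and "simplicial_map K L f" and "simplicial_map K L g"
  shows "(same_contiguity_class K L f g \<longrightarrow> P_homotopic K L f g) \<and>
    (finite K \<and> P_homotopic K L f g \<longrightarrow> same_contiguity_class K L f g) \<and>
    (finite K \<longrightarrow> (same_contiguity_class K L f g \<longleftrightarrow> P_homotopic K L f g))"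
  using same_contiguity_class_imp_P_homotopic[OF assms(1,2)]
    P_homotopic_imp_same_contiguity_class[OF assms(1,2)] finite_vertices[OF assms(1)]
  by blast

end
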